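(* Fix $\tau>0$ and let $(z^\ell)_{\ell\ge0}$ be an infinite sequence generated by the preconditioned HMLBFGS inner iteration for $\Phi_\tau$ (in any of the modes N, E, H), with all iterates in a compact subset of $\mathcal K_0$ and with the component gradients continuous on the projection of that set to $\mathbb R^n$. Let $\Phi_\tau^*=\inf_{z\in\mathbb R^{n+1}}\Phi_\tau(z)>-\infty$. Suppose that, from some index onward, the iterates and the trial segments stay in a set on which $\Phi_\tau$ has an $L_\tau$-Lipschitz gradient and satisfies, for some $\mu_{\rm PL}>0$, $$\tfrac12\|\nabla\Phi_\tau(z)\|^2\ge\mu_{\rm PL}\bigl(\Phi_\tau(z)-\Phi_\tau^*\bigr).$$ Then the objective values converge Q-linearly: there is $q_{\rm PL}\in(0,1)$ such that, for all sufficiently large $\ell$, $$\Phi_\tau(z^{\ell+1})-\Phi_\tau^*\le q_{\rm PL}\bigl(\Phi_\tau(z^\ell)-\Phi_\tau^*\bigr).$$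
   Context: Let $f_1,\dots,f_m:\mathbb R^n\to\mathbb R$ be differentiable, $f=\max_if_i$. For $\tau>0$ put $\phi_\tau(r)=\frac{r+\sqrt{r^2+\tau^2}}{2}$ and $\Phi_\tau(x,t)=t+\sum_{i=1}^m\phi_\tau(f_i(x)-t)$, $(x,t)\in\mathbb R^n\times\mathbb R$. For the initial smoothing parameter $\tau_0>0$ and $z_0=(x_0,f(x_0))$, $\mathcal K_0=\{z:\Phi_{\tau_0}(z)\le\Phi_{\tau_0}(z_0)\}$. Preconditioner. For $z=(x,t)$ put $q_i(x)=(\nabla f_i(x)^T,-1)^T$, $\omega_i=((f_i(x)-t)^2+\tau^2)^{1/2}$, let $J(z)\in\mathbb R^{m\times(n+1)}$ have rows $q_i(x)^T$, $\Pi_x=\begin{pmatrix}I_n&0\\0&0\end{pmatrix}$, $D^{\rm hyp}(z,\tau)=\operatorname{diag}(\omega_1^{-1},\dots,\omega_m^{-1})$, and $P(z,\tau)=\delta I_{n+1}+\bar L\Pi_x+\frac12J(z)^TD^{\rm hyp}(z,\tau)J(z)$, where $\delta>0$ and $\bar L=\sum_iL_i$ are fixed, $L_i\ge0$ being a Lipschitz constant of $\nabla f_i$ on a set containing the accepted iterates and every line-search trial segment. Limited-memory metric. Fixed parameters: $m_L\ge1$, $0<m_{\rm cur}<M_{\rm cur}$, $\chi_0>0$, $0<\chi_{\min}\le\chi_{\max}$. For an ordered memory $\mathcal M=\{(s_j,\widetilde y_j,\rho_j)\}_{j=1}^q$, $q\le m_L$, $\rho_j=(s_j^T\widetilde y_j)^{-1}$,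 and $P\succ0$, set $H^{(0)}=\chi P^{-1}$ with $\chi=\chi_0$ if $q=0$ and $\chi=\min\{\chi_{\max},\max\{\chi_{\min},s_q^T\widetilde y_q/(\widetilde y_q^TP^{-1}\widetilde y_q)\}\}$ if $q>0$; $H^{(j)}=(I-\rho_js_j\widetilde y_j^T)H^{(j-1)}(I-\rho_j\widetilde y_js_j^T)+\rho_js_js_j^T$; $H_{\mathcal M,P}=H^{(q)}$ and $B_{\mathcal M,P}=H_{\mathcal M,P}^{-1}$. Inner iteration for fixed $\tau$ (mode N, E or H). Start with $\mathcal M=\varnothing$. At iterate $z=z^\ell$ with $g=\nabla\Phi_\tau(z)\ne0$: let $P=P(z,\tau)$ and $d=-H_{\mathcal M,P}g$; if $g^Td\ge0$ (or on a restart), clear $\mathcal M$ and take the restart direction $d=-g$. Starting from a fixed initial trial step, backtrack by a factor $\beta\in(0,1)$ (without a cap on the number of trials) until the Armijo condition $\Phi_\tau(z+\lambda d)\le\Phi_\tau(z)+\alpha\lambda g^Td$ holds, $0<\alpha<1$; the trial segments are the segments from $z$ to the tested points $z+\lambda d$. Set $z^{\ell+1}=z+\lambda d$, $s=z^{\ell+1}-z$, $y=\nabla\Phi_\tau(z^{\ell+1})-g$, $c=s^Ty$, $\eta=\max\{m_{\rm cur}\|s\|^2,\|y\|^2/M_{\rm cur}\}$. Pair processing: if $c>\eta$, store $\widetilde y=y$; in mode N, if $c<-\eta$, store $\widetilde y=-y$; in mode E, if $c<-\eta$, store $\widetilde y=y-2c\,s/(s^Ts)$; in mode H, if $c<-m_{\rm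 cur}\|s\|^2$, put $b=B_{\mathcal M,P}s$, $\widetilde y=y-2c\,b/(s^Tb)$ and store it if $\|\widetilde y\|^2<M_{\rm cur}|c|$; otherwise discard the pair (a pair may also be discarded by an optional numerical tolerance treating $c$ as zero). When storing $(s,\widetilde y,(s^T\widetilde y)^{-1})$, append it to $\mathcal M$, deleting the oldest pair if more than $m_L$ are present. Consequently every stored pair satisfies $s^T\widetilde y/\|s\|^2>m_{\rm cur}$ and $\|\widetilde y\|^2/(s^T\widetilde y)<M_{\rm cur}$. *)

theory Defs
  imports "HOL-Analysis.Analysis"
begin

text \<open>
  Points \<open>z = (x, t)\<close> of \<open>\<real>\<^sup>n \<times> \<real>\<close> are pairs; the product type carries the Euclidean inner product
  and norm. Matrices acting on this space are represented by the linear maps they induce: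
  matrix products are compositions, transposes are adjoints, inverses of (invertible)
  matrices are function inverses.
\<close>

type_synonym 'n point = "(real ^ 'n) \<times> real"

definition gradient :: "('a::real_inner \<Rightarrow> real) \<Rightarrow> 'a \<Rightarrow> 'a" where
  "gradient F x = (THE D. GDERIV F x :> D)"

definition max_fun :: "('m::finite \<Rightarrow> 'a \<Rightarrow> real) \<Rightarrow> 'a \<Rightarrow> real" where
  "max_fun f x = Max (range (\<lambda>i. f i x))"

definition smooth_plus :: "real \<Rightarrow> real \<Rightarrow> real" where
  "smooth_plus \<tau> r = (r + sqrt (r\<^sup>2 + \<tau>\<^sup>2)) / 2"

definition Phi :: "('m::finite \<Rightarrow> real ^ 'n \<Rightarrow> real) \<Rightarrow> real \<Rightarrow> 'n::finite point \<Rightarrow> real" where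
  "Phi f \<tau> z = snd z + (\<Sum>i\<in>UNIV. smooth_plus \<tau> (f i (fst z) - snd z))"

definition level_set0 ::
  "('m::finite \<Rightarrow> real ^ 'n \<Rightarrow> real) \<Rightarrow> real \<Rightarrow> real ^ 'n \<Rightarrow> ('n::finite point) set" where
  "level_set0 f \<tau>0 x0 = {z. Phi f \<tau>0 z \<le> Phi f \<tau>0 (x0, max_fun f x0)}"

datatype hm_mode = ModeN | ModeE | ModeH

record hm_params =
  mem_cap :: nat  \<comment> \<open>\<open>m\<^sub>L\<close>\<close>
  curv_lo :: real     \<comment> \<open>\<open>m_cur\<close>\<close>
  curv_hi :: real     \<comment> \<open>\<open>M_cur\<close>\<close>
  chi_init :: real
  chi_min :: real
  chi_max :: real
  armijo_const :: real     \<comment> \<open>\<open>\<alpha>\<close>\<close>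
  backtrack :: real   \<comment> \<open>\<open>\<beta>\<close>\<close>
  trial_init :: real  \<comment> \<open>initial trial step of every line search\<close>
  delta :: real

definition valid_params :: "hm_params \<Rightarrow> bool" where
  "valid_params p \<longleftrightarrow>
     1 \<le> mem_cap p \<and>
     0 < curv_lo p \<and> curv_lo p < curv_hi p \<and>
     0 < chi_init p \<and> 0 < chi_min p \<and> chi_min p \<le> chi_max p \<and>
     0 < armijo_const p \<and> armijo_const p < 1 \<and>
     0 < backtrack p \<and> backtrack p < 1 \<and>
     0 < trial_init p \<and>
     0 < delta p"

definition qvec :: "('m \<Rightarrow> real ^ 'n \<Rightarrow> real) \<Rightarrow> 'm \<Rightarrow> real ^ 'n \<Rightarrow> 'n::finite point" where
  "qvec f i x = (gradient (f i) x, -1)"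

definition omega ::
  "('m \<Rightarrow> real ^ 'n \<Rightarrow> real) \<Rightarrow> real \<Rightarrow> 'm \<Rightarrow> 'n::finite point \<Rightarrow> real" where
  "omega f \<tau> i z = sqrt ((f i (fst z) - snd z)\<^sup>2 + \<tau>\<^sup>2)"

definition Jmap ::
  "('m::finite \<Rightarrow> real ^ 'n \<Rightarrow> real) \<Rightarrow> 'n::finite point \<Rightarrow> 'n point \<Rightarrow> real ^ 'm" where
  "Jmap f z v = (\<chi> i. qvec f i (fst z) \<bullet> v)"

definition Pi_x :: "'n::finite point \<Rightarrow> 'n point" where
  "Pi_x v = (fst v, 0)"

definition Dhyp ::
  "('m::finite \<Rightarrow> real ^ 'n \<Rightarrow> real) \<Rightarrow> real \<Rightarrow> 'n::finite point \<Rightarrow> real ^ 'm \<Rightarrow> real ^ 'm" where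
  "Dhyp f \<tau> z w = (\<chi> i. inverse (omega f \<tau> i z) * w $ i)"

definition precond ::
  "('m::finite \<Rightarrow> real ^ 'n \<Rightarrow> real) \<Rightarrow> ('m \<Rightarrow> real) \<Rightarrow> real \<Rightarrow> real \<Rightarrow>
   'n::finite point \<Rightarrow> 'n point \<Rightarrow> 'n point" where
  "precond f L \<delta> \<tau> z v =
     \<delta> *\<^sub>R v + (\<Sum>i\<in>UNIV. L i) *\<^sub>R Pi_x v
       + (1 / 2) *\<^sub>R adjoint (Jmap f z) (Dhyp f \<tau> z (Jmap f z v))"

text \<open>A memory is a list of triples \<open>(s, y, \<rho>)\<close>, oldest first.\<close>

type_synonym 'a memory = "('a \<times> 'a \<times> real) list"

definition outer :: "'a::real_inner \<Rightarrow> 'a \<Rightarrow> 'a \<Rightarrow> 'a" where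
  "outer a b v = (b \<bullet> v) *\<^sub>R a"

definition bfgs_update ::
  "'a::real_inner \<times> 'a \<times> real \<Rightarrow> ('a \<Rightarrow> 'a) \<Rightarrow> 'a \<Rightarrow> 'a" where
  "bfgs_update tr H = (case tr of (s, y, \<rho>) \<Rightarrow>
     (\<lambda>v. ((\<lambda>u. u - \<rho> *\<^sub>R outer s y u) \<circ> H \<circ> (\<lambda>u. u - \<rho> *\<^sub>R outer y s u)) v
           + \<rho> *\<^sub>R outer s s v))"

definition chi_scale :: "hm_params \<Rightarrow> 'a::real_inner memory \<Rightarrow> ('a \<Rightarrow> 'a) \<Rightarrow> real" where
  "chi_scale p M P =
     (if M = [] then chi_init p
      else case last M of (s, y, \<rho>) \<Rightarrow>
        min (chi_max p) (max (chi_min p) ((s \<bullet> y) / (y \<bullet> inv P y))))"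

definition lbfgs_H :: "hm_params \<Rightarrow> 'a::real_inner memory \<Rightarrow> ('a \<Rightarrow> 'a) \<Rightarrow> 'a \<Rightarrow> 'a" where
  "lbfgs_H p M P = fold bfgs_update M (\<lambda>v. chi_scale p M P *\<^sub>R inv P v)"

definition lbfgs_B :: "hm_params \<Rightarrow> 'a::real_inner memory \<Rightarrow> ('a \<Rightarrow> 'a) \<Rightarrow> 'a \<Rightarrow> 'a" where
  "lbfgs_B p M P = inv (lbfgs_H p M P)"

text \<open>
  The curvature vector to be stored with \<open>s\<close>, or \<open>None\<close> if the pair is discarded;
  \<open>B\<close> is only used in mode H.
\<close>

definition pair_rule ::
  "hm_params \<Rightarrow> hm_mode \<Rightarrow> ('a::real_inner \<Rightarrow> 'a) \<Rightarrow> 'a \<Rightarrow> 'a \<Rightarrow> 'a option" where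
  "pair_rule p md B s y =
     (let c = s \<bullet> y;
          \<eta> = max (curv_lo p * (norm s)\<^sup>2) ((norm y)\<^sup>2 / curv_hi p)
      in if c > \<eta> then Some y
         else (case md of
             ModeN \<Rightarrow> if c < - \<eta> then Some (- y) else None
           | ModeE \<Rightarrow> if c < - \<eta> then Some (y - (2 * c / (s \<bullet> s)) *\<^sub>R s) else None
           | ModeH \<Rightarrow>
               if c < - (curv_lo p * (norm s)\<^sup>2) then
                 (let b = B s; y' = y - (2 * c / (s \<bullet> b)) *\<^sub>R b
                  in if (norm y')\<^sup>2 < curv_hi p * \<bar>c\<bar> then Some y' else None)
               else None))"

definition store_pair ::
  "hm_params \<Rightarrow> 'a::real_inner memory \<Rightarrow> 'a \<Rightarrow> 'a \<Rightarrow> 'a memory" where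
  "store_pair p M s y =
     (let M' = M @ [(s, y, inverse (s \<bullet> y))]
      in if length M' > mem_cap p then tl M' else M')"

text \<open>
  \<open>tol\<close> is the optional numerical tolerance: a pair with \<open>\<bar>c\<bar> \<le> tol\<close> is treated as having
  \<open>c = 0\<close>. The choice \<open>tol = 0\<close> switches the test off, since pairs with \<open>c = 0\<close> are
  discarded by the pair rule anyway.
\<close>

definition process_pair ::
  "hm_params \<Rightarrow> hm_mode \<Rightarrow> real \<Rightarrow> ('a::real_inner \<Rightarrow> 'a) \<Rightarrow> 'a memory \<Rightarrow> 'a \<Rightarrow> 'a \<Rightarrow> 'a memory" where
  "process_pair p md tol B M s y =
     (if \<bar>s \<bullet> y\<bar> \<le> tol then M
      else case pair_rule p md B s y of None \<Rightarrow> M | Some y' \<Rightarrow> store_pair p M s y')"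

definition trial_step :: "hm_params \<Rightarrow> nat \<Rightarrow> real" where
  "trial_step p j = trial_init p * backtrack p ^ j"

definition armijo :: "hm_params \<Rightarrow> ('a::real_inner \<Rightarrow> real) \<Rightarrow> 'a \<Rightarrow> 'a \<Rightarrow> real \<Rightarrow> bool" where
  "armijo p F z d r \<longleftrightarrow>
     F (z + r *\<^sub>R d) \<le> F z + armijo_const p * r * (gradient F z \<bullet> d)"

text \<open>
  One iteration from \<open>(z, M)\<close> to \<open>(z', M')\<close> with search direction \<open>d\<close> and \<open>k\<close> backtracking
  reductions. \<open>Mc\<close> is the memory after the restart test. A restart is forced if
  \<open>g \<bullet> d \<ge> 0\<close> holds for the quasi-Newton direction; since no further restart criterion
  is prescribed, it may also happen at any other iteration.
\<close>

definition hm_step ::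
  "hm_params \<Rightarrow> hm_mode \<Rightarrow> ('m::finite \<Rightarrow> real ^ 'n \<Rightarrow> real) \<Rightarrow> ('m \<Rightarrow> real) \<Rightarrow> real \<Rightarrow> real \<Rightarrow>
   'n::finite point \<Rightarrow> 'n point memory \<Rightarrow> 'n point \<Rightarrow> nat \<Rightarrow>
   'n point \<Rightarrow> 'n point memory \<Rightarrow> bool" where
  "hm_step p md f L \<tau> tol z M d k z' M' \<longleftrightarrow>
     (let F = Phi f \<tau>;
          g = gradient F z;
          P = precond f L (delta p) \<tau> z;
          s = z' - z;
          y = gradient F z' - g
      in g \<noteq> 0 \<and>
         (\<exists>Mc. (Mc = M \<and> d = - lbfgs_H p M P g \<and> g \<bullet> d < 0 \<or> Mc = [] \<and> d = - g) \<and>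
               M' = process_pair p md tol (lbfgs_B p Mc P) Mc s y) \<and>
         armijo p F z d (trial_step p k) \<and>
         (\<forall>j<k. \<not> armijo p F z d (trial_step p j)) \<and>
         z' = z + trial_step p k *\<^sub>R d)"

definition hm_run ::
  "hm_params \<Rightarrow> hm_mode \<Rightarrow> ('m::finite \<Rightarrow> real ^ 'n \<Rightarrow> real) \<Rightarrow> ('m \<Rightarrow> real) \<Rightarrow> real \<Rightarrow>
   (nat \<Rightarrow> real) \<Rightarrow> (nat \<Rightarrow> 'n::finite point) \<Rightarrow> (nat \<Rightarrow> 'n point memory) \<Rightarrow>
   (nat \<Rightarrow> 'n point) \<Rightarrow> (nat \<Rightarrow> nat) \<Rightarrow> bool" where
  "hm_run p md f L \<tau> tol z M d k \<longleftrightarrow>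
     M 0 = [] \<and>
     (\<forall>l. 0 \<le> tol l \<and>
          hm_step p md f L \<tau> (tol l) (z l) (M l) (d l) (k l) (z (Suc l)) (M (Suc l)))"

text \<open>
  The union of the segments from \<open>z\<close> to all tested points \<open>z + \<lambda> d\<close>, the accepted one included.
\<close>

definition trial_segments :: "hm_params \<Rightarrow> 'a::real_inner \<Rightarrow> 'a \<Rightarrow> nat \<Rightarrow> 'a set" where
  "trial_segments p z d k = (\<Union>j\<le>k. closed_segment z (z + trial_step p j *\<^sub>R d))"

end

theory Submission
  imports Defs
begin

text \<open>
  The preconditioner is bounded and coercive uniformly over the compact set of iterates. Storing only
  pairs of bounded curvature makes each BFGS update preserve such bounds up to fixed constants, and
  the memory has bounded length, so the directions are uniformly gradient related. A rejected
  trial step is bounded away from zero by the Lipschitz constant of the gradient, hence so are the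
  accepted steps: every iteration decreases the objective by at least a fixed multiple of the squared
  gradient norm, and the Polyak--Lojasiewicz inequality turns this into a linear contraction.
\<close>

section \<open>Coercive bounded operators and their inverses\<close>

text \<open>Coercivity and an operator norm bound stand in for bounds on the extreme eigenvalues.
  For a direction \<open>- H g\<close> they are exactly the two halves of being gradient related:
  sufficient descent and length comparable to \<open>norm g\<close>.\<close>

definition elliptic :: "real \<Rightarrow> real \<Rightarrow> ('a::euclidean_space \<Rightarrow> 'a) \<Rightarrow> bool" where
  "elliptic h K H \<longleftrightarrow>
     linear H \<and> (\<forall>v. h * (norm v)\<^sup>2 \<le> v \<bullet> H v) \<and> (\<forall>v. norm (H v) \<le> K * norm v)"

lemma ellipticI:
  assumes "linear H" "\<And>v. h * (norm v)\<^sup>2 \<le> v \<bullet> H v" "\<And>v. norm (H v) \<le> K * norm v"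
  shows "elliptic h K H"
  using assms by (simp add: elliptic_def)

lemma ellipticD:
  assumes "elliptic h K H"
  shows "linear H" "h * (norm v)\<^sup>2 \<le> v \<bullet> H v" "norm (H v) \<le> K * norm v"
  using assms by (simp_all add: elliptic_def)

lemma elliptic_mono:
  assumes "elliptic h K H" "h' \<le> h" "K \<le> K'"
  shows "elliptic h' K' H"
proof (rule ellipticI)
  fix v :: 'a
  have "h' * (norm v)\<^sup>2 \<le> h * (norm v)\<^sup>2" "K * norm v \<le> K' * norm v"
    using assms(2,3) by (simp_all add: mult_right_mono)
  then show "h' * (norm v)\<^sup>2 \<le> v \<bullet> H v" "norm (H v) \<le> K' * norm v"
    using ellipticD(2,3)[OF assms(1), of v] by linarith+
qed (rule ellipticD(1)[OF assms(1)])

lemma elliptic_id: "elliptic 1 1 (\<lambda>v. v)"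
  by (simp add: elliptic_def linear_id[unfolded id_def] power2_norm_eq_inner)

lemma elliptic_bij:
  assumes "elliptic h K H" "0 < h"
  shows "bij H"
proof -
  have "v = 0" if "H v = 0" for v
    using ellipticD(2)[OF assms(1), of v] that assms(2) by (simp add: mult_le_0_iff)
  then have "inj H"
    using ellipticD(1)[OF assms(1)] by (simp add: linear_injective_0)
  then show ?thesis
    using ellipticD(1)[OF assms(1)] linear_injective_imp_surjective by (auto simp: bij_def)
qed

text \<open>With \<open>u = inv P v\<close>, coercivity of \<open>P\<close> at \<open>u\<close> and
  Cauchy-Schwarz bound \<open>norm u\<close> by \<open>norm v / h\<close>. The lower bound combines
  the same coercivity with \<open>norm v \<le> K * norm u\<close>, which is where the square of
  \<open>K\<close> comes from.\<close>

lemma elliptic_inv: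
  assumes P: "elliptic h K P" and "0 < h" "0 < K"
  shows "elliptic (h / K\<^sup>2) (1 / h) (inv P)"
proof (rule ellipticI)
  have bij: "bij P"
    using elliptic_bij assms by blast
  show "linear (inv P)"
    using ellipticD(1)[OF P] bij by (simp add: linear_injective_left_inverse bij_def inj_linear_imp_inv_linear)
  fix v
  define u where "u = inv P v"
  have v: "v = P u"
    using bij by (simp add: u_def bij_def surj_f_inv_f)
  have low: "h * (norm u)\<^sup>2 \<le> u \<bullet> v"
    using ellipticD(2)[OF P, of u] v by simp
  have "(norm v)\<^sup>2 \<le> K\<^sup>2 * (norm u)\<^sup>2"
    using ellipticD(3)[OF P, of u] v by (metis norm_ge_zero power_mono power_mult_distrib)
  then have "h * (norm v)\<^sup>2 \<le> h * (K\<^sup>2 * (norm u)\<^sup>2)"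
    using assms(2) by simp
  also have "\<dots> \<le> K\<^sup>2 * (u \<bullet> v)"
    using mult_left_mono[OF low, of "K\<^sup>2"] by (simp add: algebra_simps)
  finally show "h / K\<^sup>2 * (norm v)\<^sup>2 \<le> v \<bullet> inv P v"
    using assms(3) by (simp add: u_def[symmetric] field_simps inner_commute)
  have "h * norm u * norm u \<le> norm v * norm u"
    using low norm_cauchy_schwarz[of u v] by (simp add: power2_eq_square algebra_simps)
  then have "h * norm u \<le> norm v"
    by (cases "u = 0") (auto simp: mult_le_cancel_right)
  then show "norm (inv P v) \<le> 1 / h * norm v"
    using assms(2) by (simp add: u_def[symmetric] field_simps)
qed

lemma elliptic_scale:
  assumes "elliptic h K H" "0 \<le> h" "0 \<le> K" "0 \<le> a" "a \<le> c" "c \<le> b"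
  shows "elliptic (a * h) (b * K) (\<lambda>v. c *\<^sub>R H v)"
proof (rule ellipticI)
  show "linear (\<lambda>v. c *\<^sub>R H v)"
    using linear_compose_scale_right[OF ellipticD(1)[OF assms(1)]] .
  fix v
  have "a * (h * (norm v)\<^sup>2) \<le> c * (v \<bullet> H v)" "c * norm (H v) \<le> b * (K * norm v)"
    using assms ellipticD(2,3)[OF assms(1), of v] by (auto intro!: mult_mono)
  then show "a * h * (norm v)\<^sup>2 \<le> v \<bullet> c *\<^sub>R H v" "norm (c *\<^sub>R H v) \<le> b * K * norm v"
    using assms by (simp_all add: mult.assoc)
qed

section \<open>Stability of the bounds under BFGS updates\<close>

text \<open>The two curvature tests are kept in nonstrict form; the separate clause
  \<open>0 < s \<bullet> y\<close> makes the reciprocal meaningful.\<close>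

definition curvature_pair :: "real \<Rightarrow> real \<Rightarrow> 'a::real_inner \<times> 'a \<times> real \<Rightarrow> bool" where
  "curvature_pair lo hi tr \<longleftrightarrow> (case tr of (s, y, \<rho>) \<Rightarrow>
     0 < s \<bullet> y \<and> lo * (norm s)\<^sup>2 \<le> s \<bullet> y \<and> (norm y)\<^sup>2 \<le> hi * (s \<bullet> y) \<and> \<rho> = inverse (s \<bullet> y))"

text \<open>The upper bound holds because both factors around \<open>H\<close> are rank-one
  perturbations of the identity with norm at most \<open>1 + sqrt (hi / lo)\<close>. For the lower
  bound, \<open>v\<close> splits into a part on which \<open>H\<close> is coercive and a multiple of
  \<open>y\<close>; the latter is paid for by the added rank-one term, since
  \<open>(norm y)\<^sup>2 \<le> hi * (s \<bullet> y)\<close>.\<close>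

lemma elliptic_bfgs_update:
  assumes H: "elliptic h K H" and tr: "curvature_pair lo hi tr"
    and pos: "0 < h" "0 < K" "0 < lo" "0 < hi"
  shows "elliptic (min (h / 2) (1 / (2 * hi))) ((1 + sqrt (hi / lo))\<^sup>2 * K + 1 / lo)
           (bfgs_update tr H)"
proof -
  obtain s y \<rho> where tr_eq: "tr = (s, y, \<rho>)"
    by (cases tr)
  define c where "c = s \<bullet> y"
  \<comment> \<open>\<open>V\<close> is the factor to the right of \<open>H\<close> and
    \<open>W\<close>, the factor to the left, is its adjoint, so the quadratic form of the product
    is that of \<open>H\<close> at \<open>V v\<close>.\<close>
  define V where "V v = v - (\<rho> * (s \<bullet> v)) *\<^sub>R y" for v
  define W where "W v = v - (\<rho> * (y \<bullet> v)) *\<^sub>R s" for v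
  define \<kappa> where "\<kappa> = sqrt (hi / lo)"
  have c: "0 < c" "lo * (norm s)\<^sup>2 \<le> c" "(norm y)\<^sup>2 \<le> hi * c" and \<rho>: "\<rho> = 1 / c"
    using tr by (simp_all add: curvature_pair_def tr_eq c_def field_simps)
  have upd: "bfgs_update tr H v = W (H (V v)) + (\<rho> * (s \<bullet> v)) *\<^sub>R s" for v
    by (simp add: bfgs_update_def tr_eq outer_def V_def W_def)
  have lin: "linear H"
    using ellipticD(1)[OF H] .
  have adj: "v \<bullet> W u = V v \<bullet> u" for u v
    by (simp add: V_def W_def algebra_simps inner_commute)
  \<comment> \<open>Multiplying the two curvature bounds limits how far \<open>s\<close> and
    \<open>y\<close> can be from parallel.\<close>
  have "(norm s * norm y)\<^sup>2 \<le> (hi / lo) * c\<^sup>2"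
  proof -
    have "lo * (norm s)\<^sup>2 * (norm y)\<^sup>2 \<le> c * (hi * c)"
      using c pos by (intro mult_mono) auto
    then show ?thesis
      using pos by (simp add: field_simps power2_eq_square)
  qed
  then have "norm s * norm y \<le> sqrt ((hi / lo) * c\<^sup>2)"
    by (rule real_le_rsqrt)
  also have "\<dots> = \<kappa> * c"
    using c by (simp only: \<kappa>_def real_sqrt_mult real_sqrt_abs abs_of_pos)
  finally have \<kappa>: "\<rho> * (norm s * norm y) \<le> \<kappa>"
    using c by (simp add: \<rho> field_simps)
  \<comment> \<open>Stated for \<open>a\<close> and \<open>b\<close> so that it serves both
    \<open>V\<close> and \<open>W\<close>, in which \<open>s\<close> and \<open>y\<close> trade
    places.\<close>
  have proj: "norm (v - (\<rho> * (a \<bullet> v)) *\<^sub>R b) \<le> (1 + \<kappa>) * norm v"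
    if "norm a * norm b = norm s * norm y" for a b v :: 'a
  proof -
    have "norm ((\<rho> * (a \<bullet> v)) *\<^sub>R b) \<le> \<rho> * (norm a * norm v) * norm b"
      using c Cauchy_Schwarz_ineq2[of a v] by (simp add: \<rho> abs_mult divide_simps mult_right_mono)
    also have "\<dots> = \<rho> * (norm s * norm y) * norm v"
      using that by (simp add: algebra_simps)
    also have "\<dots> \<le> \<kappa> * norm v"
      using \<kappa> by (rule mult_right_mono) simp
    finally show ?thesis
      using norm_triangle_ineq4[of v "(\<rho> * (a \<bullet> v)) *\<^sub>R b"] by (simp add: algebra_simps)
  qed
  have \<kappa>0: "0 \<le> \<kappa>"
    using pos by (simp add: \<kappa>_def)
  show ?thesis
  proof (rule ellipticI)
    show "linear (bfgs_update tr H)"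
      by (rule linearI)
        (simp_all add: upd V_def W_def linear_add[OF lin] linear_diff[OF lin] linear_cmul[OF lin]
          algebra_simps inner_simps)
    fix v
    have "norm (bfgs_update tr H v) \<le> norm (W (H (V v))) + norm ((\<rho> * (s \<bullet> v)) *\<^sub>R s)"
      unfolding upd by (rule norm_triangle_ineq)
    moreover have "norm (W (H (V v))) \<le> (1 + \<kappa>)\<^sup>2 * K * norm v"
    proof -
      have "norm (W (H (V v))) \<le> (1 + \<kappa>) * norm (H (V v))"
        unfolding W_def by (rule proj) simp
      also have "\<dots> \<le> (1 + \<kappa>) * (K * norm (V v))"
        using ellipticD(3)[OF H] \<kappa>0 by (intro mult_left_mono) auto
      also have "\<dots> \<le> (1 + \<kappa>) * (K * ((1 + \<kappa>) * norm v))"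
        using proj[of s y v] \<kappa>0 pos by (intro mult_left_mono) (auto simp: V_def)
      finally show ?thesis
        by (simp add: power2_eq_square algebra_simps)
    qed
    moreover have "norm ((\<rho> * (s \<bullet> v)) *\<^sub>R s) \<le> 1 / lo * norm v"
    proof -
      have "norm ((\<rho> * (s \<bullet> v)) *\<^sub>R s) \<le> \<rho> * (norm s * norm v) * norm s"
        using c Cauchy_Schwarz_ineq2[of s v] by (simp add: \<rho> abs_mult divide_simps mult_right_mono)
      also have "\<dots> = (\<rho> * (norm s)\<^sup>2) * norm v"
        by (simp add: power2_eq_square)
      also have "\<dots> \<le> 1 / lo * norm v"
        using c pos by (intro mult_right_mono) (auto simp: \<rho> field_simps)
      finally show ?thesis .
    qed
    ultimately show "norm (bfgs_update tr H v) \<le> ((1 + sqrt (hi / lo))\<^sup>2 * K + 1 / lo) * norm v"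
      unfolding \<kappa>_def by (simp add: distrib_right)
    \<comment> \<open>\<open>r\<close> is the contribution of the added rank-one term to the
      quadratic form at \<open>v\<close>.\<close>
    define r where "r = \<rho> * (s \<bullet> v)\<^sup>2"
    let ?h = "min (h / 2) (1 / (2 * hi))"
    have r: "0 \<le> r"
      using c by (simp add: r_def \<rho>)
    have "v = V v + (\<rho> * (s \<bullet> v)) *\<^sub>R y"
      by (simp add: V_def)
    then have "norm v \<le> norm (V v) + norm ((\<rho> * (s \<bullet> v)) *\<^sub>R y)"
      by (metis norm_triangle_ineq)
    then have "(norm v)\<^sup>2 \<le> (norm (V v) + norm ((\<rho> * (s \<bullet> v)) *\<^sub>R y))\<^sup>2"
      by (simp add: power_mono)
    also have "\<dots> \<le> 2 * (norm (V v))\<^sup>2 + 2 * (norm ((\<rho> * (s \<bullet> v)) *\<^sub>R y))\<^sup>2"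
      using zero_le_power2[of "norm (V v) - norm ((\<rho> * (s \<bullet> v)) *\<^sub>R y)"]
      by (simp add: power2_eq_square algebra_simps)
    also have "(norm ((\<rho> * (s \<bullet> v)) *\<^sub>R y))\<^sup>2 \<le> hi * r"
    proof -
      have "(norm ((\<rho> * (s \<bullet> v)) *\<^sub>R y))\<^sup>2 = (\<rho> * (s \<bullet> v))\<^sup>2 * (norm y)\<^sup>2"
        by (simp add: power_mult_distrib)
      also have "\<dots> \<le> (\<rho> * (s \<bullet> v))\<^sup>2 * (hi * c)"
        using c by (intro mult_left_mono) auto
      also have "\<dots> = hi * r"
        using c by (simp add: r_def \<rho> power2_eq_square)
      finally show ?thesis .
    qed
    finally have "(norm v)\<^sup>2 \<le> 2 * (norm (V v))\<^sup>2 + 2 * (hi * r)"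
      by simp
    then have "?h * (norm v)\<^sup>2 \<le> ?h * (2 * (norm (V v))\<^sup>2 + 2 * (hi * r))"
      using pos by (intro mult_left_mono) auto
    also have "\<dots> = ?h * (2 * (norm (V v))\<^sup>2) + ?h * (2 * (hi * r))"
      by (rule distrib_left)
    \<comment> \<open>The first argument of the minimum is spent on the \<open>V v\<close> term and
      the second on the \<open>r\<close> term; their halves cancel the factors 2 from squaring the
      sum.\<close>
    also have "\<dots> \<le> (h / 2) * (2 * (norm (V v))\<^sup>2) + (1 / (2 * hi)) * (2 * (hi * r))"
      using pos r by (intro add_mono mult_right_mono) auto
    also have "\<dots> = h * (norm (V v))\<^sup>2 + r"
      using pos by simp
    also have "\<dots> \<le> V v \<bullet> H (V v) + r"
      using ellipticD(2)[OF H] by simp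
    also have "\<dots> = v \<bullet> bfgs_update tr H v"
      by (simp add: upd inner_add_right adj r_def power2_eq_square inner_commute)
    finally show "?h * (norm v)\<^sup>2 \<le> v \<bullet> bfgs_update tr H v" .
  qed
qed

text \<open>Each update worsens the bounds by a fixed rule, so a bound \<open>n\<close> on the
  number of updates yields constants valid for all lists and all starting operators at once.\<close>

lemma elliptic_fold_bfgs_update:
  fixes h K lo hi :: real
  assumes "0 < h" "0 < K" "0 < lo" "0 < hi"
  shows "\<exists>h'>0. \<exists>K'>0. \<forall>M (H :: 'a::euclidean_space \<Rightarrow> 'a).
           length M \<le> n \<longrightarrow> (\<forall>tr\<in>set M. curvature_pair lo hi tr) \<longrightarrow> elliptic h K H
           \<longrightarrow> elliptic h' K' (fold bfgs_update M H)"
  using assms(1,2)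
\<comment> \<open>\<open>fold\<close> applies the head first, so the tail starts from the worsened
  bounds; hence \<open>h\<close> and \<open>K\<close> vary in the induction.\<close>
proof (induction n arbitrary: h K)
  case 0
  then show ?case
    by (intro exI[of _ h], intro conjI exI[of _ K]) auto
next
  case (Suc n)
  let ?h = "min (h / 2) (1 / (2 * hi))" and ?K = "(1 + sqrt (hi / lo))\<^sup>2 * K + 1 / lo"
  have "0 < ?h" "0 < ?K"
    using Suc.prems assms(3,4) by (auto intro!: add_nonneg_pos)
  from Suc.IH[OF this] obtain h' K' where pos: "0 < h'" "0 < K'"
    and IH: "\<And>M (H :: 'a \<Rightarrow> 'a). length M \<le> n \<Longrightarrow> \<forall>tr\<in>set M. curvature_pair lo hi tr \<Longrightarrow>
               elliptic ?h ?K H \<Longrightarrow> elliptic h' K' (fold bfgs_update M H)"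
    by blast
  show ?case
  \<comment> \<open>The minimum and maximum with the original bounds cover the empty list, which
    leaves \<open>H\<close> unchanged.\<close>
  proof (rule exI[of _ "min h h'"], rule conjI[OF _ exI[of _ "max K K'"]], goal_cases)
    case 2
    show ?case
    proof (intro conjI allI impI)
      fix M :: "'a memory" and H :: "'a \<Rightarrow> 'a"
      assume M: "length M \<le> Suc n" "\<forall>tr\<in>set M. curvature_pair lo hi tr" and H: "elliptic h K H"
      show "elliptic (min h h') (max K K') (fold bfgs_update M H)"
      proof (cases M)
        case Nil
        then show ?thesis
          using elliptic_mono[OF H] by simp
      next
        case (Cons tr N)
        then have "elliptic ?h ?K (bfgs_update tr H)"
          using elliptic_bfgs_update[OF H] M Suc.prems assms(3,4) by auto
        from elliptic_mono[OF IH[OF _ _ this, of N]] show ?thesis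
          using Cons M by simp
      qed
    qed (use pos Suc.prems in auto)
  qed (use pos Suc.prems in auto)
qed

section \<open>The limited-memory operator and the admissibility of its memory\<close>

text \<open>Clipping alone confines the scale, whatever the value of the quotient inside.\<close>

lemma chi_scale_bounds:
  assumes "valid_params p"
  shows "min (chi_init p) (chi_min p) \<le> chi_scale p M P"
    "chi_scale p M P \<le> max (chi_init p) (chi_max p)"
  using assms by (auto simp: chi_scale_def valid_params_def split: prod.splits)

definition admissible_memory :: "hm_params \<Rightarrow> 'a::real_inner memory \<Rightarrow> bool" where
  "admissible_memory p M \<longleftrightarrow>
     length M \<le> mem_cap p \<and> (\<forall>tr\<in>set M. curvature_pair (curv_lo p) (curv_hi p) tr)"

text \<open>The constants precede the quantification over memory and preconditioner: this uniformity
  lets one pair of bounds serve all iterations. The scaled inverse has fixed bounds, and at most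
  \<open>mem_cap p\<close> updates follow.\<close>

lemma elliptic_lbfgs_H:
  fixes h K :: real
  assumes p: "valid_params p" and pos: "0 < h" "0 < K"
  shows "\<exists>h'>0. \<exists>K'>0. \<forall>M (P :: 'a::euclidean_space \<Rightarrow> 'a).
           admissible_memory p M \<longrightarrow> elliptic h K P \<longrightarrow> elliptic h' K' (lbfgs_H p M P)"
proof -
  let ?a = "min (chi_init p) (chi_min p)" and ?b = "max (chi_init p) (chi_max p)"
  have p': "0 < ?a" "0 < ?b" "0 < curv_lo p" "0 < curv_hi p"
    using p by (auto simp: valid_params_def)
  have start: "elliptic (?a * (h / K\<^sup>2)) (?b * (1 / h)) (\<lambda>v. chi_scale p M P *\<^sub>R inv P v)"
    if "elliptic h K P" for M and P :: "'a \<Rightarrow> 'a"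
    using that pos p' chi_scale_bounds[OF p]
    by (intro elliptic_scale elliptic_inv) auto
  have pos': "0 < ?a * (h / K\<^sup>2)" "0 < ?b * (1 / h)"
    using p' pos by (auto intro!: mult_pos_pos)
  from elliptic_fold_bfgs_update[OF pos' p'(3,4), where 'a = 'a, of "mem_cap p"]
  show ?thesis
    using start unfolding lbfgs_H_def admissible_memory_def by meson
qed

text \<open>In modes N and E the modification is a negation or a reflection along \<open>s\<close>:
  it keeps the norm of \<open>y\<close> and reverses the sign of \<open>s \<bullet> y\<close>, so
  the threshold test carries over. In mode H the norm bound is tested by the rule itself, and
  coercivity of \<open>H\<close> makes \<open>s \<bullet> B s\<close> positive, so the correction
  again reverses the sign.\<close>

lemma pair_rule_curvature:
  fixes B H :: "'a::euclidean_space \<Rightarrow> 'a"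
  assumes p: "valid_params p" and H: "elliptic h K H" "0 < h" and B: "B = inv H"
    and rule: "pair_rule p md B s y = Some y'"
  shows "curvature_pair (curv_lo p) (curv_hi p) (s, y', inverse (s \<bullet> y'))"
proof -
  define c where "c = s \<bullet> y"
  define \<eta> where "\<eta> = max (curv_lo p * (norm s)\<^sup>2) ((norm y)\<^sup>2 / curv_hi p)"
  have pos: "0 < curv_lo p" "0 < curv_hi p"
    using p by (auto simp: valid_params_def)
  have nn: "0 \<le> curv_lo p * (norm s)\<^sup>2"
    using pos by simp
  \<comment> \<open>The threshold depends on \<open>y\<close> only through its norm, so one
    criterion covers modes N and E as well as the unmodified pair.\<close>
  have suff: "curvature_pair (curv_lo p) (curv_hi p) (s, u, inverse (s \<bullet> u))"
    if "\<eta> < s \<bullet> u" "norm u = norm y" for u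
    using that nn pos
    by (auto simp: curvature_pair_def \<eta>_def field_simps intro: le_less_trans[OF nn])
  consider "c > \<eta>" "y' = y"
    | "md = ModeN" "c < - \<eta>" "y' = - y"
    | "md = ModeE" "c < - \<eta>" "y' = y - (2 * c / (s \<bullet> s)) *\<^sub>R s"
    | "md = ModeH" "c < - (curv_lo p * (norm s)\<^sup>2)" "y' = y - (2 * c / (s \<bullet> B s)) *\<^sub>R B s"
      "(norm y')\<^sup>2 < curv_hi p * \<bar>c\<bar>"
    using rule unfolding pair_rule_def Let_def c_def[symmetric] \<eta>_def[symmetric]
    by (cases md) (auto split: if_splits)
  then show ?thesis
  proof cases
    case 1
    then show ?thesis
      using suff[of y] by (simp add: c_def)
  next
    case 2
    then show ?thesis
      using suff[of "- y"] by (simp add: c_def)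
  next
    case 3
    have "c < 0"
      using 3(2) nn by (simp add: \<eta>_def)
    then have s: "s \<bullet> s \<noteq> 0"
      by (auto simp: c_def)
    have "s \<bullet> y' = - c"
      using s by (simp add: 3(3) inner_diff_right c_def[symmetric])
    moreover have "y' \<bullet> y' = y \<bullet> y"
      using s by (simp add: 3(3) inner_diff_right inner_diff_left inner_commute[of y s] c_def[symmetric])
    ultimately show ?thesis
      using 3(2) suff[of y'] by (simp add: norm_eq_sqrt_inner)
  next
    case 4
    have c: "c < 0"
      using 4(2) nn by simp
    \<comment> \<open>Written this way, \<open>s \<bullet> B s\<close> is the quadratic form of
      \<open>H\<close> at \<open>B s\<close>, and \<open>c < 0\<close> excludes
      \<open>B s = 0\<close>.\<close>
    have "s = H (B s)"
      using elliptic_bij[OF H] by (simp add: B bij_def surj_f_inv_f)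
    moreover have "B s \<noteq> 0"
      using \<open>s = H (B s)\<close> linear_0[OF ellipticD(1)[OF H(1)]] c by (auto simp: c_def)
    ultimately have "0 < s \<bullet> B s"
      using ellipticD(2)[OF H(1), of "B s"] H(2)
      by (metis inner_commute less_le_trans mult_pos_pos zero_less_norm_iff zero_less_power)
    then have "s \<bullet> y' = - c"
      by (simp add: 4(3) inner_diff_right c_def[symmetric])
    then show ?thesis
      using 4(2,4) c by (simp add: curvature_pair_def)
  qed
qed

lemma admissible_store_pair:
  assumes "admissible_memory p M"
    "curvature_pair (curv_lo p) (curv_hi p) (s, y, inverse (s \<bullet> y))"
  shows "admissible_memory p (store_pair p M s y)"
  using assms
  by (cases M) (auto simp: admissible_memory_def store_pair_def Let_def)

lemma admissible_process_pair:
  fixes H :: "'a::euclidean_space \<Rightarrow> 'a"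
  assumes "valid_params p" "elliptic h K H" "0 < h" "admissible_memory p M"
  shows "admissible_memory p (process_pair p md tol (inv H) M s y)"
  using assms(4)
  by (auto simp: process_pair_def split: option.splits
      intro: admissible_store_pair pair_rule_curvature[OF assms(1-3) refl])

section \<open>Uniform bounds for the preconditioner\<close>

text \<open>Passing to the bilinear form removes the adjoint; linearity, coercivity and boundedness
  are then read off from this sum.\<close>

lemma inner_precond:
  fixes f :: "'m::finite \<Rightarrow> real ^ 'n::finite \<Rightarrow> real"
  shows "u \<bullet> precond f L \<delta> \<tau> z v =
     \<delta> * (u \<bullet> v) + (\<Sum>i\<in>UNIV. L i) * (fst u \<bullet> fst v)
       + 1 / 2 * (\<Sum>i\<in>UNIV. inverse (omega f \<tau> i z) * (qvec f i (fst z) \<bullet> u) * (qvec f i (fst z) \<bullet> v))"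
proof -
  have lin: "linear (Jmap f z)"
    by (rule linearI) (simp_all add: Jmap_def vec_eq_iff inner_add_right)
  have "u \<bullet> adjoint (Jmap f z) (Dhyp f \<tau> z (Jmap f z v)) = Jmap f z u \<bullet> Dhyp f \<tau> z (Jmap f z v)"
    by (rule adjoint_works[OF lin])
  also have "\<dots> = (\<Sum>i\<in>UNIV. inverse (omega f \<tau> i z) * (qvec f i (fst z) \<bullet> u) * (qvec f i (fst z) \<bullet> v))"
    unfolding Jmap_def Dhyp_def inner_vec_def[where 'b = 'm]
    by (rule sum.cong) simp_all
  finally have "u \<bullet> adjoint (Jmap f z) (Dhyp f \<tau> z (Jmap f z v)) = \<dots>" .
  moreover have "u \<bullet> Pi_x v = fst u \<bullet> fst v"
    by (cases u) (simp add: Pi_x_def)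
  ultimately show ?thesis
    by (simp only: precond_def inner_add_right inner_scaleR_right)
qed

lemma linear_precond:
  fixes f :: "'m::finite \<Rightarrow> real ^ 'n::finite \<Rightarrow> real"
  shows "linear (precond f L \<delta> \<tau> z)"
proof (rule linearI)
  fix v w :: "'n point" and c :: real
  have "u \<bullet> precond f L \<delta> \<tau> z (v + w) = u \<bullet> (precond f L \<delta> \<tau> z v + precond f L \<delta> \<tau> z w)" for u
    by (simp only: inner_precond inner_add_right fst_add distrib_left sum.distrib)
  then show "precond f L \<delta> \<tau> z (v + w) = precond f L \<delta> \<tau> z v + precond f L \<delta> \<tau> z w"
    by (metis vector_eq_ldot)
  have "u \<bullet> precond f L \<delta> \<tau> z (c *\<^sub>R v) = u \<bullet> (c *\<^sub>R precond f L \<delta> \<tau> z v)" for u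
    by (simp add: inner_precond sum_distrib_left algebra_simps)
  then show "precond f L \<delta> \<tau> z (c *\<^sub>R v) = c *\<^sub>R precond f L \<delta> \<tau> z v"
    by (metis vector_eq_ldot)
qed

text \<open>The term with \<open>\<delta>\<close> alone gives coercivity, as the other two are
  positive semidefinite. For the upper bound, \<open>omega\<close> is at least \<open>\<tau>\<close>
  and each \<open>qvec\<close> has norm at most \<open>G + 1\<close>.\<close>

lemma elliptic_precond:
  fixes f :: "'m::finite \<Rightarrow> real ^ 'n::finite \<Rightarrow> real"
  assumes "0 < \<delta>" "0 < \<tau>" "\<And>i. 0 \<le> L i" "\<And>i. norm (gradient (f i) (fst z)) \<le> G"
  shows "elliptic \<delta> (\<delta> + (\<Sum>i\<in>UNIV. L i) + (\<Sum>i\<in>(UNIV::'m set). (G + 1)\<^sup>2 / \<tau>))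
           (precond f L \<delta> \<tau> z)"
proof (rule ellipticI[OF linear_precond])
  let ?L = "\<Sum>i\<in>UNIV. L i" and ?q = "\<lambda>i. qvec f i (fst z)" and ?P = "precond f L \<delta> \<tau> z"
  let ?K = "\<delta> + ?L + (\<Sum>i\<in>(UNIV::'m set). (G + 1)\<^sup>2 / \<tau>)"
  have L: "0 \<le> ?L"
    using assms(3) by (simp add: sum_nonneg)
  have \<omega>: "\<tau> \<le> omega f \<tau> i z" for i
    using assms(2) by (auto simp: omega_def intro!: real_le_rsqrt)
  then have \<omega>0: "0 < omega f \<tau> i z" for i
    using assms(2) less_le_trans by blast
  fix v
  show "\<delta> * (norm v)\<^sup>2 \<le> v \<bullet> ?P v"
    using L \<omega>0[THEN less_imp_le] unfolding inner_precond power2_norm_eq_inner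
    by (simp add: sum_nonneg mult.assoc)
  have G: "0 \<le> G"
    using assms(4) norm_ge_zero order_trans by blast
  have q: "norm (?q i) \<le> G + 1" for i
    using norm_Pair_le[of "gradient (f i) (fst z)" "-1 :: real"] assms(4)[of i] by (simp add: qvec_def)
  have le: "u \<bullet> ?P v \<le> ?K * (norm u * norm v)" for u
  proof -
    have "inverse (omega f \<tau> i z) * (?q i \<bullet> u) * (?q i \<bullet> v) \<le> (G + 1)\<^sup>2 / \<tau> * (norm u * norm v)" for i
    proof -
      have "\<bar>?q i \<bullet> w\<bar> \<le> (G + 1) * norm w" for w
        using Cauchy_Schwarz_ineq2[of "?q i" w] mult_right_mono[OF q[of i], of "norm w"] by simp
      then have "\<bar>inverse (omega f \<tau> i z) * (?q i \<bullet> u) * (?q i \<bullet> v)\<bar>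
          \<le> inverse \<tau> * ((G + 1) * norm u) * ((G + 1) * norm v)"
        unfolding abs_mult using \<omega>[of i] \<omega>0[of i] assms(2) G
        by (intro mult_mono) (auto simp: le_imp_inverse_le)
      then show ?thesis
        by (simp add: power2_eq_square divide_inverse algebra_simps)
    qed
    then have "(\<Sum>i\<in>UNIV. inverse (omega f \<tau> i z) * (?q i \<bullet> u) * (?q i \<bullet> v))
        \<le> (\<Sum>i\<in>(UNIV::'m set). (G + 1)\<^sup>2 / \<tau>) * (norm u * norm v)"
      unfolding sum_distrib_right by (rule sum_mono)
    \<comment> \<open>Nonnegativity allows the factor 1/2 of the last term to be dropped.\<close>
    moreover have "0 \<le> (\<Sum>i\<in>(UNIV::'m set). (G + 1)\<^sup>2 / \<tau>) * (norm u * norm v)"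
      using assms(2) by (intro mult_nonneg_nonneg sum_nonneg) auto
    moreover have "\<delta> * (u \<bullet> v) \<le> \<delta> * (norm u * norm v)"
      using assms(1) norm_cauchy_schwarz by simp
    moreover have "?L * (fst u \<bullet> fst v) \<le> ?L * (norm u * norm v)"
    proof (rule mult_left_mono[OF _ L])
      have "norm (fst w) \<le> norm w" for w :: "'n point"
        using norm_fst_le[of "fst w" "snd w"] by simp
      then have "norm (fst u) * norm (fst v) \<le> norm u * norm v"
        by (intro mult_mono) auto
      then show "fst u \<bullet> fst v \<le> norm u * norm v"
        using norm_cauchy_schwarz order_trans by blast
    qed
    ultimately show ?thesis
      unfolding inner_precond distrib_right by linarith
  qed
  \<comment> \<open>Testing with \<open>u = ?P v\<close> turns the bilinear bound into a norm bound
    after cancelling one factor \<open>norm (?P v)\<close>.\<close>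
  have "norm (?P v) * norm (?P v) \<le> ?K * norm v * norm (?P v)"
    using le[of "?P v"] by (simp add: power2_norm_eq_inner[symmetric] power2_eq_square algebra_simps)
  moreover have "0 \<le> ?K * norm v"
    using assms(1-3) by (intro mult_nonneg_nonneg add_nonneg_nonneg sum_nonneg) auto
  ultimately show "norm (?P v) \<le> ?K * norm v"
    by (cases "?P v = 0") (auto simp: mult_le_cancel_right)
qed

section \<open>Gradients and differentiability of the smoothed objective\<close>

text \<open>\<open>gradient\<close> is a definite description, so it needs existence and uniqueness;
  the Riesz vector of the derivative \<open>F'\<close> is \<open>adjoint F' 1\<close>.\<close>

lemma GDERIV_gradient:
  fixes F :: "'a::euclidean_space \<Rightarrow> real"
  assumes "F differentiable (at x)"
  shows "GDERIV F x :> gradient F x"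
proof -
  obtain F' where F': "(F has_derivative F') (at x)"
    using assms by (auto simp: differentiable_def)
  have "F' = (\<lambda>h. h \<bullet> adjoint F' 1)"
    using adjoint_works[OF has_derivative_linear[OF F'], of _ 1] by (auto simp: fun_eq_iff)
  then have D: "GDERIV F x :> adjoint F' 1"
    using F' unfolding gderiv_def by metis
  have "E = adjoint F' 1" if "GDERIV F x :> E" for E
    using has_derivative_unique[OF that[unfolded gderiv_def] D[unfolded gderiv_def]]
    by (metis vector_eq_ldot)
  then show ?thesis
    unfolding gradient_def using D by (rule theI[rotated])
qed

text \<open>Positivity of \<open>\<tau>\<close> keeps the argument of the square root away from 0,
  where the root is not differentiable.\<close>

lemma Phi_differentiable:
  assumes "\<And>i x. f i differentiable (at x)" "0 < \<tau>"
  shows "Phi f \<tau> differentiable (at w)"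
proof -
  have f: "(\<lambda>w. f i (fst w)) differentiable (at w)" for i
    using differentiable_chain_at[of fst w "f i"] assms(1)
    by (simp add: o_def linear_imp_differentiable linear_fst)
  have s: "sqrt differentiable (at r)" if "0 < r" for r
    using DERIV_real_sqrt[OF that] by (auto simp: real_differentiable_def)
  have "(\<lambda>w. smooth_plus \<tau> (f i (fst w) - snd w)) differentiable (at w)" for i
  proof -
    have "0 < (f i (fst w) - snd w)\<^sup>2 + \<tau>\<^sup>2"
      using assms(2) by (simp add: add_nonneg_pos)
    moreover have *: "(\<lambda>w. f i (fst w) - snd w) differentiable (at w)"
      using f[of i] by (intro differentiable_diff) (simp_all add: linear_imp_differentiable linear_snd)
    moreover have "(\<lambda>w. (f i (fst w) - snd w)\<^sup>2 + \<tau>\<^sup>2) differentiable (at w)"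
      using * by (intro differentiable_add differentiable_power differentiable_const)
    ultimately have "(\<lambda>w. sqrt ((f i (fst w) - snd w)\<^sup>2 + \<tau>\<^sup>2)) differentiable (at w)"
      using differentiable_chain_at[of "\<lambda>w. (f i (fst w) - snd w)\<^sup>2 + \<tau>\<^sup>2" w sqrt] s
      by (simp add: o_def)
    then have "(\<lambda>w. (1 / 2) *\<^sub>R (f i (fst w) - snd w + sqrt ((f i (fst w) - snd w)\<^sup>2 + \<tau>\<^sup>2)))
        differentiable (at w)"
      using * by (intro differentiable_scaleR differentiable_add differentiable_const)
    then show ?thesis
      by (simp add: smooth_plus_def)
  qed
  then show ?thesis
    unfolding Phi_def
    by (intro differentiable_add differentiable_sum linear_imp_differentiable linear_snd) simp_all
qed

section \<open>Descent estimate and step lengths of the line search\<close>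

text \<open>The mean value theorem replaces the usual integral, which costs a factor 2 in the
  quadratic term. The Lipschitz bound compares two points of the segment only.\<close>

lemma descent_step:
  fixes F :: "'a::euclidean_space \<Rightarrow> real"
  assumes diff: "\<And>x. F differentiable (at x)"
    and lip: "\<Lambda>-lipschitz_on S (gradient F)"
    and seg: "closed_segment z (z + r *\<^sub>R d) \<subseteq> S" and r: "0 < r"
  shows "F (z + r *\<^sub>R d) \<le> F z + r * (gradient F z \<bullet> d) + \<Lambda> * r\<^sup>2 * (norm d)\<^sup>2"
proof -
  let ?\<phi> = "\<lambda>t. F (z + t *\<^sub>R d)"
  have "(?\<phi> has_real_derivative gradient F (z + t *\<^sub>R d) \<bullet> d) (at t)" for t
  proof -
    have "((\<lambda>t. z + t *\<^sub>R d) has_derivative (\<lambda>t. t *\<^sub>R d)) (at t)"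
      by (auto intro!: derivative_eq_intros)
    from has_derivative_compose[OF this GDERIV_gradient[OF diff, unfolded gderiv_def]]
    show ?thesis
      by (simp add: has_field_derivative_def mult.commute[of _ "_ \<bullet> _"] inner_commute
          fun_eq_iff[symmetric])
  qed
  then obtain t where t: "0 < t" "t < r" and eq: "?\<phi> r - ?\<phi> 0 = r * (gradient F (z + t *\<^sub>R d) \<bullet> d)"
    using MVT2[of 0 r ?\<phi> "\<lambda>t. gradient F (z + t *\<^sub>R d) \<bullet> d"] r by auto
  have "z + t *\<^sub>R d = (1 - t / r) *\<^sub>R z + (t / r) *\<^sub>R (z + r *\<^sub>R d)"
    using r by (simp add: algebra_simps)
  then have "z + t *\<^sub>R d \<in> closed_segment z (z + r *\<^sub>R d)"
    using t by (auto simp: closed_segment_def intro!: exI[of _ "t / r"])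
  then have "norm (gradient F (z + t *\<^sub>R d) - gradient F z) \<le> \<Lambda> * (t * norm d)"
    using lipschitz_onD[OF lip, of "z + t *\<^sub>R d" z] seg t by (auto simp: dist_norm)
  also have "\<dots> \<le> \<Lambda> * (r * norm d)"
    using t lipschitz_on_nonneg[OF lip] by (intro mult_left_mono mult_right_mono) auto
  finally have "norm (gradient F (z + t *\<^sub>R d) - gradient F z) * norm d \<le> \<Lambda> * (r * norm d) * norm d"
    by (rule mult_right_mono) simp
  then have "(gradient F (z + t *\<^sub>R d) - gradient F z) \<bullet> d \<le> \<Lambda> * r * (norm d)\<^sup>2"
    using norm_cauchy_schwarz[of "gradient F (z + t *\<^sub>R d) - gradient F z" d]
    by (simp add: power2_eq_square algebra_simps)
  then have "r * (gradient F (z + t *\<^sub>R d) \<bullet> d) \<le> r * (gradient F z \<bullet> d + \<Lambda> * r * (norm d)\<^sup>2)"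
    using r by (simp add: inner_diff_left)
  then show ?thesis
    using eq by (simp add: power2_eq_square algebra_simps)
qed

lemma trial_step_pos: "valid_params p \<Longrightarrow> 0 < trial_step p j"
  by (simp add: trial_step_def valid_params_def)

text \<open>The \<open>+ 1\<close> guards against the junk value of a division by \<open>\<Lambda> = 0\<close>.\<close>

lemma accepted_step_bounded_below:
  fixes F :: "'a::euclidean_space \<Rightarrow> real"
  assumes p: "valid_params p"
    and diff: "\<And>x. F differentiable (at x)"
    and lip: "\<Lambda>-lipschitz_on S (gradient F)"
    and seg: "trial_segments p z d k \<subseteq> S"
    and rejected: "\<And>j. j < k \<Longrightarrow> \<not> armijo p F z d (trial_step p j)"
    and d: "gradient F z \<bullet> d \<le> - (h * (norm (gradient F z))\<^sup>2)"
      "norm d \<le> K * norm (gradient F z)"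
    and pos: "0 < h" "0 < K" "gradient F z \<noteq> 0"
  shows "min (trial_init p) (backtrack p * ((1 - armijo_const p) * h / ((\<Lambda> + 1) * K\<^sup>2)))
           \<le> trial_step p k"
proof (cases k)
  case 0
  then show ?thesis
    by (simp add: trial_step_def)
next
  case (Suc j)
  define g where "g = gradient F z"
  \<comment> \<open>The last rejected step, larger than the accepted one by exactly one backtracking
    factor.\<close>
  define r where "r = trial_step p j"
  have r: "0 < r"
    using trial_step_pos[OF p] by (simp add: r_def)
  have pp: "0 < backtrack p" "armijo_const p < 1"
    using p by (auto simp: valid_params_def)
  have \<Lambda>: "0 \<le> \<Lambda>"
    using lipschitz_on_nonneg[OF lip] .
  have "closed_segment z (z + r *\<^sub>R d) \<subseteq> S"
    using seg Suc by (force simp: trial_segments_def r_def)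
  \<comment> \<open>A failed Armijo test against the descent estimate forces the quadratic term to
    be large, hence \<open>r\<close> to be large.\<close>
  from descent_step[OF diff lip this r] rejected[of j] Suc
  have "r * (armijo_const p * (g \<bullet> d)) < r * (g \<bullet> d + \<Lambda> * r * (norm d)\<^sup>2)"
    by (simp add: armijo_def r_def[symmetric] g_def[symmetric] power2_eq_square algebra_simps)
  then have "(1 - armijo_const p) * (- (g \<bullet> d)) < \<Lambda> * r * (norm d)\<^sup>2"
    unfolding mult_less_cancel_left_pos[OF r] by (simp add: algebra_simps)
  moreover have "(1 - armijo_const p) * (h * (norm g)\<^sup>2) \<le> (1 - armijo_const p) * (- (g \<bullet> d))"
    using d(1) pp by (intro mult_left_mono) (auto simp: g_def)
  moreover have "\<Lambda> * r * (norm d)\<^sup>2 \<le> (\<Lambda> + 1) * r * (K\<^sup>2 * (norm g)\<^sup>2)"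
    using r \<Lambda> power_mono[OF d(2), of 2]
    by (intro mult_mono) (auto simp: g_def power_mult_distrib)
  ultimately have "((1 - armijo_const p) * h) * (norm g)\<^sup>2 < (r * ((\<Lambda> + 1) * K\<^sup>2)) * (norm g)\<^sup>2"
    by (simp add: algebra_simps)
  then have "(1 - armijo_const p) * h < r * ((\<Lambda> + 1) * K\<^sup>2)"
    by (rule mult_right_less_imp_less) simp
  then have "(1 - armijo_const p) * h / ((\<Lambda> + 1) * K\<^sup>2) \<le> r"
    using pos \<Lambda> by (simp add: pos_divide_le_eq)
  then have "backtrack p * ((1 - armijo_const p) * h / ((\<Lambda> + 1) * K\<^sup>2)) \<le> backtrack p * r"
    using pp by (intro mult_left_mono) auto
  also have "\<dots> = trial_step p k"
    by (simp add: trial_step_def r_def Suc)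
  finally show ?thesis
    by simp
qed

section \<open>Linear convergence under the Polyak-Lojasiewicz inequality\<close>

theorem theorem9p1:
  fixes f :: "'m::finite \<Rightarrow> real ^ 'n::finite \<Rightarrow> real"
    and L :: "'m \<Rightarrow> real"
    and p :: hm_params and md :: hm_mode
    and \<tau> \<tau>0 L\<tau> \<mu>PL :: real
    and x0 :: "real ^ 'n"
    and tol :: "nat \<Rightarrow> real"
    and z d :: "nat \<Rightarrow> 'n point"
    and M :: "nat \<Rightarrow> 'n point memory"
    and k :: "nat \<Rightarrow> nat"
    and U :: "(real ^ 'n) set"
    and C S :: "('n point) set"
    and l0 :: nat
  assumes differentiable: "\<And>i x. f i differentiable (at x)"
    and params: "valid_params p"
    and tau: "\<tau>0 > 0" "\<tau> > 0"
    and run: "hm_run p md f L \<tau> tol z M d k"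
    and component_lipschitz: "\<And>i. (L i)-lipschitz_on U (gradient (f i))"
    and component_lipschitz_set:
      "\<And>l. fst (z l) \<in> U" "\<And>l. fst ` trial_segments p (z l) (d l) (k l) \<subseteq> U"
    and compact_iterates: "compact C" "C \<subseteq> level_set0 f \<tau>0 x0" "\<And>l. z l \<in> C"
    and gradients_continuous: "\<And>i. continuous_on (fst ` C) (gradient (f i))"
    and bounded_below: "bdd_below (range (Phi f \<tau>))"
    and tail: "\<And>l. l \<ge> l0 \<Longrightarrow> z l \<in> S"
      "\<And>l. l \<ge> l0 \<Longrightarrow> trial_segments p (z l) (d l) (k l) \<subseteq> S"
    and smooth: "L\<tau>-lipschitz_on S (gradient (Phi f \<tau>))"
    and PL: "\<mu>PL > 0"
      "\<And>w. w \<in> S \<Longrightarrow>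
         1 / 2 * (norm (gradient (Phi f \<tau>) w))\<^sup>2 \<ge> \<mu>PL * (Phi f \<tau> w - (INF v. Phi f \<tau> v))"
  shows "\<exists>qPL. 0 < qPL \<and> qPL < 1 \<and>
           (\<forall>\<^sub>F l in sequentially.
              Phi f \<tau> (z (Suc l)) - (INF v. Phi f \<tau> v)
                \<le> qPL * (Phi f \<tau> (z l) - (INF v. Phi f \<tau> v)))"
proof -
  let ?F = "Phi f \<tau>" and ?g = "\<lambda>l. gradient (Phi f \<tau>) (z l)"
  let ?P = "\<lambda>l. precond f L (delta p) \<tau> (z l)"
  have p: "0 < delta p" "0 < trial_init p" "0 < backtrack p" "0 < armijo_const p" "armijo_const p < 1"
    using params by (auto simp: valid_params_def)
  have L: "0 \<le> L i" for i
    using lipschitz_on_nonneg[OF component_lipschitz] .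
  have "compact (gradient (f i) ` fst ` C)" for i
    using compact_iterates(1) gradients_continuous
    by (intro compact_continuous_image) (auto intro: continuous_on_fst continuous_on_id)
  then have "bounded (\<Union>i. gradient (f i) ` fst ` C)"
    by (intro bounded_UN) (auto intro: compact_imp_bounded)
  \<comment> \<open>One bound works for all components, since there are finitely many and
    \<open>C\<close> has compact projection.\<close>
  then obtain G where G: "\<And>i w. w \<in> C \<Longrightarrow> norm (gradient (f i) (fst w)) \<le> G"
    by (auto simp: bounded_iff)
  define KP where "KP = delta p + (\<Sum>i\<in>UNIV. L i) + (\<Sum>i\<in>(UNIV::'m set). (G + 1)\<^sup>2 / \<tau>)"
  have P: "elliptic (delta p) KP (?P l)" for l
    unfolding KP_def using p tau L G compact_iterates(3) by (intro elliptic_precond) auto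
  have "0 < KP"
    unfolding KP_def using p(1) L tau by (intro add_pos_nonneg sum_nonneg) auto
  from elliptic_lbfgs_H[OF params p(1) this, where 'a = "'n point"]
  obtain h' K' where "0 < h'" "0 < K'"
    and H: "\<And>l N. admissible_memory p N \<Longrightarrow> elliptic h' K' (lbfgs_H p N (?P l))"
    using P by blast
  \<comment> \<open>Including 1 in the minimum and maximum covers the restart direction, whose
    operator is the identity.\<close>
  define h where "h = min 1 h'"
  define K where "K = max 1 K'"
  have hK: "0 < h" "0 < K" "h \<le> 1" "h \<le> h'" "1 \<le> K" "K' \<le> K"
    using \<open>0 < h'\<close> \<open>0 < K'\<close> by (auto simp: h_def K_def)

  have step: "hm_step p md f L \<tau> (tol l) (z l) (M l) (d l) (k l) (z (Suc l)) (M (Suc l))" for l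
    using run by (simp add: hm_run_def)
  \<comment> \<open>Clearing keeps admissibility, and the operator bounds for the current memory are
    what mode H needs to store a valid pair; so the invariant passes to the next iteration.\<close>
  have mem: "admissible_memory p (M l)" for l
  proof (induction l)
    case 0
    then show ?case
      using run by (simp add: hm_run_def admissible_memory_def)
  next
    case (Suc l)
    obtain Mc where Mc: "Mc = M l \<or> Mc = []" and eq: "M (Suc l) =
        process_pair p md (tol l) (lbfgs_B p Mc (?P l)) Mc (z (Suc l) - z l) (?g (Suc l) - ?g l)"
      using step[of l] unfolding hm_step_def Let_def by blast
    have "admissible_memory p Mc"
      using Mc Suc by (auto simp: admissible_memory_def)
    then show ?case
      unfolding eq lbfgs_B_def
      using admissible_process_pair[OF params H \<open>0 < h'\<close>] by blast
  qed
  have dir: "?g l \<bullet> d l \<le> - (h * (norm (?g l))\<^sup>2) \<and> norm (d l) \<le> K * norm (?g l)" for l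
  proof -
    obtain A where A: "elliptic h K A" and "d l = - A (?g l)"
    proof -
      consider "d l = - lbfgs_H p (M l) (?P l) (?g l)" | "d l = - ?g l"
        using step[of l] unfolding hm_step_def Let_def by blast
      then show ?thesis
        using that elliptic_mono[OF H[OF mem] hK(4,6)] elliptic_mono[OF elliptic_id hK(3,5)]
        by cases blast+
    qed
    then show ?thesis
      using ellipticD(2,3)[OF A, of "?g l"] by simp
  qed

  define r where
    "r = min (trial_init p) (backtrack p * ((1 - armijo_const p) * h / ((L\<tau> + 1) * K\<^sup>2)))"
  have "0 \<le> L\<tau>"
    using lipschitz_on_nonneg[OF smooth] .
  then have r: "0 < r"
    using p hK by (simp add: r_def)
  \<comment> \<open>The Armijo decrease is at least \<open>armijo_const p * r * h\<close> times the
    squared gradient norm, and the factor \<open>2 * \<mu>PL\<close> converts the latter into the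
    objective gap.\<close>
  define a where "a = armijo_const p * r * h * (2 * \<mu>PL)"
  have a: "0 < a"
    using p r hK PL(1) by (simp add: a_def)
  have contract: "?F (z (Suc l)) - (INF v. ?F v) \<le> (1 - a) * (?F (z l) - (INF v. ?F v))"
    if l: "l0 \<le> l" for l
  proof -
    have g: "?g l \<noteq> 0" and acc: "armijo p ?F (z l) (d l) (trial_step p (k l))"
      and rej: "\<And>j. j < k l \<Longrightarrow> \<not> armijo p ?F (z l) (d l) (trial_step p j)"
      and z: "z (Suc l) = z l + trial_step p (k l) *\<^sub>R d l"
      using step[of l] unfolding hm_step_def Let_def by auto
    have "r \<le> trial_step p (k l)"
      unfolding r_def using dir[of l] g hK
      by (intro accepted_step_bounded_below[OF params Phi_differentiable[OF differentiable tau(2)]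
            smooth tail(2)[OF l] rej]) auto
    then have "armijo_const p * r * (h * (norm (?g l))\<^sup>2)
        \<le> armijo_const p * trial_step p (k l) * - (?g l \<bullet> d l)"
      using dir[of l] p hK r by (intro mult_mono) auto
    then have "?F (z (Suc l)) \<le> ?F (z l) - armijo_const p * r * h * (norm (?g l))\<^sup>2"
      using acc by (simp add: armijo_def z)
    moreover have "a * (?F (z l) - (INF v. ?F v)) \<le> armijo_const p * r * h * (norm (?g l))\<^sup>2"
      using mult_left_mono[OF PL(2)[OF tail(1)[OF l]], of "armijo_const p * r * h * 2"] p r hK
      by (simp add: a_def algebra_simps)
    ultimately show ?thesis
      by (simp add: algebra_simps)
  qed
  \<comment> \<open>The maximum with 1/2 keeps the rate positive without an upper bound on
    \<open>a\<close>.\<close>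
  define q where "q = max (1 / 2) (1 - a)"
  have "?F (z (Suc l)) - (INF v. ?F v) \<le> q * (?F (z l) - (INF v. ?F v))" if "l0 \<le> l" for l
  proof -
    \<comment> \<open>Boundedness below makes the gap nonnegative, so enlarging the factor from
      \<open>1 - a\<close> to \<open>q\<close> preserves the inequality.\<close>
    have "(INF v. ?F v) \<le> ?F (z l)"
      using bounded_below by (simp add: cINF_lower)
    then have "(1 - a) * (?F (z l) - (INF v. ?F v)) \<le> q * (?F (z l) - (INF v. ?F v))"
      by (intro mult_right_mono) (auto simp: q_def)
    then show ?thesis
      using contract[OF that] by linarith
  qed
  moreover have "0 < q" "q < 1"
    using a by (auto simp: q_def)
  ultimately show ?thesis
    unfolding eventually_sequentially by blast
qed

end
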